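(* For every integer $n \geq 2$, let $q(n)$ be the largest real $\rho$ for which the polytope $$Q_{n,\rho} := \Big\{x \in [0,1]^n : \sum_{i \in S}(1-x_i) + \sum_{i \notin S} x_i \geq \rho,\ \forall S \subseteq [n]\Big\}$$ has $\mathrm{Las}$-rank $n$. Then $$\frac{n+1}{2^{n+2}-n-3} \leq q(n) \leq \frac{n}{2^{n+1}-2}.$$
   Context: Notation. $[n] := \{1,\ldots,n\}$. For $P \subseteq [0,1]^n$, the integer hull is $P_I := \mathrm{conv}(P \cap \{0,1\}^n)$. Let $\mathcal{F} := \{0,1\}^n$. For $S \subseteq [n]$ let $S|_1 := \{x \in \mathcal{F} : x_i = 1\ \forall i \in S\}$ (so $\emptyset|_1 = \mathcal{F}$), and write $i|_1$ for $\{i\}|_1$. For an integer $\ell \geq 0$ let $\mathcal{A}_\ell^+ := \{S|_1 : S \subseteq [n],\ |S| \leq \ell\}$. For a vector $y$ indexed by a family containing $\mathcal{F}$ and all $i|_1$, let $\hat{x}(y) := (y_{\mathcal{F}}, y_{1|_1},\ldots,y_{n|_1})^\top$. For a matrix $Y$, $Ye_\alpha$ is its column indexed by $\alpha$. The Lasserre operator. Let $P := \{x \in [0,1]^n : Ax \leq b\}$ with $A \in \mathbb{R}^{m \times n}$, $b \in \mathbb{R}^m$ (the operator is applied to this explicit description), and let $k \geq 1$ be an integer. Let $\widehat{\mathrm{Las}}^k(P)$ be the set of real symmetric positive semidefinite matrices $Y$ with rows and columns indexed by $\mathcal{A}_{k+1}^+$ such that: (Las1) $Y[\mathcal{F},\mathcal{F}]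 = 1$; (Las2) for every $i \in [m]$, the symmetric matrix $Y^i$ indexed by $\mathcal{A}_k^+$ with entries $Y^i[S|_1,S'|_1] := b_i Y[S|_1,S'|_1] - \sum_{j=1}^n A[i,j]\, Y[(S\cup\{j\})|_1,(S'\cup\{j\})|_1]$ is positive semidefinite; (Las3) for all $\alpha_1,\alpha_2,\beta_1,\beta_2 \in \mathcal{A}_{k+1}^+$ with $\alpha_1\cap\beta_1 = \alpha_2\cap\beta_2$: $Y[\alpha_1,\beta_1] = Y[\alpha_2,\beta_2]$. Then $\mathrm{Las}^k(P) := \{x \in \mathbb{R}^n : \exists\, Y \in \widehat{\mathrm{Las}}^k(P),\ \hat{x}(Ye_{\mathcal{F}}) = (1,x)^\top\}$, and $\mathrm{Las}^0(P) := P$. The $\mathrm{Las}$-rank of $P$ is the smallest integer $k \geq 0$ such that $\mathrm{Las}^k(P) = P_I$. Here $Q_{n,\rho}$ is described by its $2^n$ defining inequalities, one for each $S \subseteq [n]$ (in addition to the box $[0,1]^n$). *)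

theory Defs
  imports "HOL-Analysis.Analysis"
begin

text \<open>
  The ground set $[n]$ is rendered as a finite index type \<^typ>\<open>'n\<close>, so $n$ is
  \<open>CARD('n)\<close>; the rows of a system $Ax \le b$ are indexed by a finite type \<^typ>\<open>'m\<close>.
\<close>

definition box_polytope :: "real ^ 'n ^ 'm \<Rightarrow> real ^ 'm \<Rightarrow> (real ^ 'n) set" where
  "box_polytope A b = {x. (\<forall>i. 0 \<le> x $ i \<and> x $ i \<le> 1) \<and> (\<forall>i. (A *v x) $ i \<le> b $ i)}"

definition cube_points :: "(real ^ 'n) set" where
  "cube_points = {x. \<forall>i. x $ i \<in> {0, 1}}"

definition integer_hull :: "(real ^ 'n) set \<Rightarrow> (real ^ 'n) set" where
  "integer_hull P = convex hull (P \<inter> cube_points)"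

definition ones_on :: "'n set \<Rightarrow> (real ^ 'n) set" where
  "ones_on S = {x \<in> cube_points. \<forall>i\<in>S. x $ i = 1}"

definition A_plus :: "nat \<Rightarrow> (real ^ 'n) set set" where
  "A_plus l = {ones_on S | S. card S \<le> l}"

text \<open>
  A matrix with rows and columns indexed by a finite set \<open>I\<close> is a binary function of which
  only the values on \<open>I \<times> I\<close> matter.
\<close>

definition psd_on :: "'a set \<Rightarrow> ('a \<Rightarrow> 'a \<Rightarrow> real) \<Rightarrow> bool" where
  "psd_on I M \<longleftrightarrow>
     (\<forall>\<alpha>\<in>I. \<forall>\<beta>\<in>I. M \<alpha> \<beta> = M \<beta> \<alpha>) \<and>
     (\<forall>v. 0 \<le> (\<Sum>\<alpha>\<in>I. \<Sum>\<beta>\<in>I. v \<alpha> * M \<alpha> \<beta> * v \<beta>))"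

text \<open>
  Since \<^const>\<open>ones_on\<close> is injective, the matrices $Y^i$ are indexed below by the sets \<open>S\<close> with
  \<open>card S \<le> k\<close> rather than by the corresponding members \<open>ones_on S\<close> of \<open>A_plus k\<close>.
\<close>

definition localizing_matrix ::
  "real ^ 'n ^ 'm \<Rightarrow> real ^ 'm \<Rightarrow> ((real ^ 'n) set \<Rightarrow> (real ^ 'n) set \<Rightarrow> real) \<Rightarrow> 'm
    \<Rightarrow> 'n set \<Rightarrow> 'n set \<Rightarrow> real" where
  "localizing_matrix A b Y i S S' =
     b $ i * Y (ones_on S) (ones_on S')
     - (\<Sum>j\<in>UNIV. A $ i $ j * Y (ones_on (S \<union> {j})) (ones_on (S' \<union> {j})))"

definition Las_lift ::
  "nat \<Rightarrow> real ^ 'n ^ 'm \<Rightarrow> real ^ 'm \<Rightarrow> ((real ^ 'n) set \<Rightarrow> (real ^ 'n) set \<Rightarrow> real) set" where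
  "Las_lift k A b = {Y.
     psd_on (A_plus (k + 1)) Y \<and>
     Y cube_points cube_points = 1 \<and>
     (\<forall>i. psd_on {S. card S \<le> k} (localizing_matrix A b Y i)) \<and>
     (\<forall>\<alpha>1\<in>A_plus (k + 1). \<forall>\<alpha>2\<in>A_plus (k + 1). \<forall>\<beta>1\<in>A_plus (k + 1). \<forall>\<beta>2\<in>A_plus (k + 1).
        \<alpha>1 \<inter> \<beta>1 = \<alpha>2 \<inter> \<beta>2 \<longrightarrow> Y \<alpha>1 \<beta>1 = Y \<alpha>2 \<beta>2)}"

definition Las :: "nat \<Rightarrow> real ^ 'n ^ 'm \<Rightarrow> real ^ 'm \<Rightarrow> (real ^ 'n) set" where
  "Las k A b =
     (if k = 0 then box_polytope A b
      else {x. \<exists>Y\<in>Las_lift k A b.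
              Y cube_points cube_points = 1 \<and> (\<forall>i. Y (ones_on {i}) cube_points = x $ i)})"

text \<open>A relation rather than a function, so that no value is assigned if no \<open>k\<close> works.\<close>

definition is_Las_rank :: "real ^ 'n ^ 'm \<Rightarrow> real ^ 'm \<Rightarrow> nat \<Rightarrow> bool" where
  "is_Las_rank A b r \<longleftrightarrow>
     Las r A b = integer_hull (box_polytope A b) \<and>
     (\<forall>k<r. Las k A b \<noteq> integer_hull (box_polytope A b))"

definition Q_poly :: "real \<Rightarrow> (real ^ 'n) set" where
  "Q_poly \<rho> = {x. (\<forall>i. 0 \<le> x $ i \<and> x $ i \<le> 1) \<and>
                  (\<forall>S. (\<Sum>i\<in>S. 1 - x $ i) + (\<Sum>i\<in>-S. x $ i) \<ge> \<rho>)}"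

text \<open>
  The defining inequality of \<^const>\<open>Q_poly\<close> for \<open>S\<close>, brought to the form \<open>A x \<le> b\<close>, reads
  $\sum_{i \in S} x_i - \sum_{i \notin S} x_i \le |S| - \rho$; the rows are indexed by the
  subsets \<open>S\<close> themselves.
\<close>

definition Q_mat :: "real ^ 'n ^ ('n set)" where
  "Q_mat = (\<chi> S i. if i \<in> S then 1 else -1)"

definition Q_rhs :: "real \<Rightarrow> real ^ ('n::finite set)" where
  "Q_rhs \<rho> = (\<chi> S. real (card S) - \<rho>)"

lemma box_polytope_Q: "box_polytope Q_mat (Q_rhs \<rho>) = (Q_poly \<rho> :: (real ^ 'n) set)"
proof -
  have "(Q_mat *v x) $ S \<le> Q_rhs \<rho> $ S \<longleftrightarrow>
        (\<Sum>i\<in>S. 1 - x $ i) + (\<Sum>i\<in>-S. x $ i) \<ge> \<rho>" for x :: "real ^ 'n" and S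
  proof -
    have "(Q_mat *v x) $ S = (\<Sum>i\<in>UNIV. if i \<in> S then x $ i else - x $ i)"
      by (auto simp: Q_mat_def matrix_vector_mult_def intro!: sum.cong)
    also have "\<dots> = (\<Sum>i\<in>S. x $ i) - (\<Sum>i\<in>-S. x $ i)"
      by (simp add: sum.If_cases sum_negf)
    finally show ?thesis
      by (auto simp: Q_rhs_def sum_subtractf)
  qed
  then show ?thesis
    by (simp add: box_polytope_def Q_poly_def)
qed

end

theory Submission
  imports Defs
begin

text \<open>
  If \<open>\<rho> \<le> 0\<close> the polytope is the whole cube, of rank 0. If \<open>\<rho> > 0\<close> it contains no vertex of the
  cube, because the vertex \<open>1\<^sub>T\<close> violates the inequality of \<open>S = T\<close>; so the integer hull is empty,
  and the rank is \<open>n\<close> exactly if level \<open>n\<close> is empty and all earlier levels are not.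

  From level \<open>n - 1\<close> on, the matrix \<open>Y\<close> is indexed by all subsets of the ground set, and Moebius
  inversion writes its entries as the moments of a (signed) weight \<open>p\<close> on the subsets. Since the
  slack of the vertex \<open>1\<^sub>T\<close> in the inequality of \<open>S\<close> is \<open>|S \<triangle> T| - \<rho>\<close>, the localizing constraint
  of level \<open>k\<close> says that \<open>\<Sum>\<^sub>T p(T) (|S \<triangle> T| - \<rho>) f(T)\<^sup>2 \<ge> 0\<close> for every polynomial \<open>f\<close> of degree at
  most \<open>k\<close>. For \<open>k = n - 1\<close> these are the functions \<open>f\<close> with \<open>\<Sum>\<^sub>T (-1)\<^sup>|\<^sup>T\<^sup>| f(T) = 0\<close>.

  The family of inequalities is invariant under the switchings \<open>T \<mapsto> S \<triangle> T\<close>, so everything is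
  decided by the uniform weight, for which each constraint asks a diagonal quadratic form with
  the single negative coefficient \<open>-\<rho>\<close> to be nonnegative on a hyperplane. By Cauchy-Schwarz this
  happens (for \<open>0 < \<rho> < 1\<close>) exactly if \<open>\<Sum>\<^bsub>U \<noteq> {}\<^esub> \<rho> / (|U| - \<rho>) \<le> 1\<close>. Hence \<open>q(n)\<close> is the root \<open>q\<close>
  in the unit interval of \<open>\<Sum>\<^sub>U 1 / (|U| - q) = 0\<close>, the sum now including \<open>U = {}\<close>. At the root,
  the uniform weight is feasible at level \<open>n - 1\<close> (lemma \<open>Las_below_dimension_nonempty\<close>); for
  \<open>\<rho> > q\<close>, the test functions \<open>(-1)\<^sup>|\<^sup>T\<^sup>| / (|S \<triangle> T| - q)\<close>, summed over all \<open>S\<close>, refute every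
  weight, uniform or not (lemma \<open>Las_lift_averaged\<close>).

  The two bounds come from the values of the defining sum: convexity of \<open>1 / x\<close> gives the upper
  one, and \<open>(k + 1) / (k - \<rho>) \<le> 2 / (1 - \<rho>)\<close> together with the closed form of
  \<open>\<Sum>\<^sub>k (n choose k) / (k + 1)\<close> the lower one.
\<close>

section \<open>Sums over the subsets of a finite type\<close>

lemma sum_sym_diff:
  fixes g :: "'n::finite set \<Rightarrow> real"
  shows "(\<Sum>S\<in>UNIV. g (sym_diff S T)) = (\<Sum>U\<in>UNIV. g U)"
  by (rule sum.reindex_bij_witness[of _ "\<lambda>U. sym_diff U T" "\<lambda>S. sym_diff S T"])
     (auto intro: arg_cong[of _ _ g])

lemma sum_card_subsets:
  fixes g :: "nat \<Rightarrow> real"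
  shows "(\<Sum>U\<in>(UNIV :: 'n::finite set set). g (card U)) = (\<Sum>k\<le>CARD('n). (CARD('n) choose k) * g k)"
proof -
  have "(\<Sum>U\<in>(UNIV :: 'n set set). g (card U))
      = (\<Sum>k\<le>CARD('n). \<Sum>U | U \<in> UNIV \<and> card (U :: 'n set) = k. g (card U))"
    by (rule sum.group[symmetric]) (auto intro: card_mono)
  also have "\<dots> = (\<Sum>k\<le>CARD('n). (CARD('n) choose k) * g k)"
  proof (rule sum.cong)
    fix k
    have "card {U :: 'n set. card U = k} = CARD('n) choose k"
      using n_subsets[of "UNIV :: 'n set" k] by simp
    then show "(\<Sum>U | U \<in> UNIV \<and> card (U :: 'n set) = k. g (card U)) = (CARD('n) choose k) * g k"
      by simp
  qed simp
  finally show ?thesis .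
qed

text \<open>Toggling an element outside \<open>I\<close> pairs the supersets of \<open>I\<close> with opposite signs.\<close>

lemma alternating_sum_supersets:
  fixes I :: "'n::finite set"
  assumes "I \<noteq> UNIV"
  shows "(\<Sum>T | I \<subseteq> T. (-1) ^ card T) = (0::real)"
proof -
  obtain j where j: "j \<notin> I" using assms by auto
  have flip: "(-1) ^ card (sym_diff T {j}) = - ((-1) ^ card T :: real)" for T :: "'n set"
  proof (cases "j \<in> T")
    case True
    then have "sym_diff T {j} = T - {j}" by auto
    moreover have "card T = Suc (card (T - {j}))" using True by (intro card.remove) simp_all
    ultimately show ?thesis by (simp only: power_Suc mult_minus1 minus_minus)
  next
    case False
    then have "sym_diff T {j} = insert j T" by auto
    moreover have "card (insert j T) = Suc (card T)" using False by simp
    ultimately show ?thesis by (simp only: power_Suc mult_minus1)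
  qed
  have "(\<Sum>T | I \<subseteq> T. (-1) ^ card T) = (\<Sum>T | I \<subseteq> T. - ((-1) ^ card T :: real))"
  proof (rule sum.reindex_bij_witness[of _ "\<lambda>T. sym_diff T {j}" "\<lambda>T. sym_diff T {j}"])
    show "- ((-1) ^ card (sym_diff T {j})) = ((-1) ^ card T :: real)" for T
      by (simp only: flip minus_minus)
  qed (use j in blast)+
  then show ?thesis by (simp add: sum_negf)
qed

text \<open>Moebius inversion over the supersets: arbitrary numbers are the moments of a signed weight.\<close>

lemma moments_of_weight:
  fixes y :: "'n::finite set \<Rightarrow> real"
  obtains p where "\<And>I. y I = (\<Sum>T | I \<subseteq> T. p T)"
proof
  define g where "g S = (\<Sum>T\<in>Pow S. (-1) ^ card T * y (- T))" for S :: "'n set"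
  fix I
  have "y I = y (- (- I))" by simp
  also have "\<dots> = (\<Sum>T\<in>Pow (- I). (-1) ^ card T * g T)"
    by (rule inclusion_exclusion_symmetric[where f = "\<lambda>T. y (- T)"]) (simp_all add: g_def)
  also have "\<dots> = (\<Sum>T | I \<subseteq> T. (-1) ^ card (- T) * g (- T))"
    by (rule sum.reindex_bij_witness[of _ uminus uminus]) auto
  finally show "y I = (\<Sum>T | I \<subseteq> T. (-1) ^ card (- T) * g (- T))" .
qed

text \<open>Moebius inversion over the subsets: the multilinear expansion of a function on the cube.
  Its top coefficient is, up to sign, the alternating sum of the values, so functions with
  vanishing alternating sum have degree less than the dimension.\<close>

lemma multilinear_expansion:
  fixes f :: "'n::finite set \<Rightarrow> real"
  assumes "k \<ge> CARD('n) \<or> k + 1 = CARD('n) \<and> (\<Sum>T\<in>UNIV. (-1) ^ card T * f T) = 0"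
  obtains v where "\<And>T. f T = (\<Sum>I | card I \<le> k \<and> I \<subseteq> T. v I)"
proof
  define g where "g S = (\<Sum>T\<in>Pow S. (-1) ^ card T * f T)" for S :: "'n set"
  fix T
  have vanish: "(-1) ^ card I * g I = 0" if "\<not> card I \<le> k" for I
  proof -
    have "card I \<le> CARD('n)" by (simp add: card_mono)
    with assms that have "card I = CARD('n)" by linarith
    then have "I = UNIV" by (simp add: card_eq_UNIV_imp_eq_UNIV)
    with assms that show ?thesis by (simp add: g_def)
  qed
  have "f T = (\<Sum>I\<in>Pow T. (-1) ^ card I * g I)"
    by (rule inclusion_exclusion_symmetric) (simp_all add: g_def)
  also have "\<dots> = (\<Sum>I | card I \<le> k \<and> I \<subseteq> T. (-1) ^ card I * g I)"
    by (rule sum.mono_neutral_right) (use vanish in auto)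
  finally show "f T = (\<Sum>I | card I \<le> k \<and> I \<subseteq> T. (-1) ^ card I * g I)" .
qed

section \<open>Moment matrices of a weight on the subsets\<close>

lemma ones_on_empty: "ones_on {} = cube_points"
  by (simp add: ones_on_def)

lemma ones_on_Int: "ones_on I \<inter> ones_on J = ones_on (I \<union> J)"
  by (auto simp: ones_on_def)

lemma finite_card_ones_on:
  fixes I :: "'n::finite set"
  shows "finite (ones_on I)" and "card (ones_on I) = card {T. I \<subseteq> T}"
proof -
  have bij: "bij_betw (\<lambda>T. \<chi> i. if i \<in> T then 1 else 0) {T. I \<subseteq> T} (ones_on I)"
    by (rule bij_betw_byWitness[where f' = "\<lambda>x. {i. x $ i = 1}"])
       (auto simp: ones_on_def cube_points_def vec_eq_iff)
  show "finite (ones_on I)" using bij_betw_finite[OF bij] by simp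
  show "card (ones_on I) = card {T. I \<subseteq> T}" using bij_betw_same_card[OF bij] by simp
qed

lemma Q_slack:
  fixes S T :: "'n::finite set"
  shows "Q_rhs \<rho> $ S - (\<Sum>j\<in>T. Q_mat $ S $ j) = real (card (sym_diff S T)) - \<rho>"
proof -
  have "(\<Sum>j\<in>T. Q_mat $ S $ j) = (\<Sum>j\<in>T. if j \<in> S then 1 else -1 :: real)"
    by (simp add: Q_mat_def)
  also have "\<dots> = real (card (T \<inter> S)) - real (card (T - S))"
    by (simp add: sum.If_cases Diff_eq)
  finally have sum: "(\<Sum>j\<in>T. Q_mat $ S $ j) = real (card (T \<inter> S)) - real (card (T - S))" .
  have "card S = card (S - T) + card (T \<inter> S)"
    using card_Int_Diff[of S T] by (simp add: Int_commute)
  moreover have "card (sym_diff S T) = card (S - T) + card (T - S)"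
    by (rule card_Un_disjoint) auto
  ultimately show ?thesis using sum by (simp add: Q_rhs_def)
qed

lemma localizing_matrix_moments:
  fixes p :: "'n::finite set \<Rightarrow> real"
  assumes Y: "\<And>I J. Y (ones_on I) (ones_on J) = (\<Sum>T | I \<union> J \<subseteq> T. p T)"
  shows "localizing_matrix Q_mat (Q_rhs \<rho>) Y S I J
    = (\<Sum>T | I \<union> J \<subseteq> T. p T * (real (card (sym_diff S T)) - \<rho>))"
proof -
  have "(\<Sum>j\<in>UNIV. Q_mat $ S $ j * Y (ones_on (I \<union> {j})) (ones_on (J \<union> {j})))
      = (\<Sum>j\<in>UNIV. \<Sum>T | T \<in> {T. I \<union> J \<subseteq> T} \<and> j \<in> T. Q_mat $ S $ j * p T)"
    by (intro sum.cong) (auto simp: Y sum_distrib_left intro!: sum.cong)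
  also have "\<dots> = (\<Sum>T | I \<union> J \<subseteq> T. \<Sum>j | j \<in> UNIV \<and> j \<in> T. Q_mat $ S $ j * p T)"
    by (rule sum.swap_restrict) auto
  also have "\<dots> = (\<Sum>T | I \<union> J \<subseteq> T. p T * (\<Sum>j\<in>T. Q_mat $ S $ j))"
    by (simp add: sum_distrib_left mult.commute)
  finally show ?thesis
    unfolding localizing_matrix_def Q_slack[symmetric]
    by (simp add: Y sum_distrib_left sum_subtractf right_diff_distrib mult.commute)
qed

text \<open>The quadratic form of a moment matrix at \<open>v\<close> integrates the square of the polynomial with
  coefficients \<open>v\<close>.\<close>

lemma moment_quadratic_form:
  fixes w v :: "'n::finite set \<Rightarrow> real"
  shows "(\<Sum>I\<in>K. \<Sum>J\<in>K. v I * (\<Sum>T | I \<union> J \<subseteq> T. w T) * v J)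
    = (\<Sum>T\<in>UNIV. w T * (\<Sum>I | I \<in> K \<and> I \<subseteq> T. v I)\<^sup>2)"
proof -
  have "(\<Sum>I\<in>K. \<Sum>J\<in>K. v I * (\<Sum>T | I \<union> J \<subseteq> T. w T) * v J)
      = (\<Sum>I\<in>K. \<Sum>J\<in>K. \<Sum>T\<in>UNIV. w T * (if I \<subseteq> T then v I else 0) * (if J \<subseteq> T then v J else 0))"
  proof (intro sum.cong refl)
    fix I J :: "'n set"
    have "v I * (\<Sum>T | I \<union> J \<subseteq> T. w T) * v J = (\<Sum>T | T \<in> UNIV \<and> I \<union> J \<subseteq> T. w T * v I * v J)"
      by (simp add: sum_distrib_left sum_distrib_right mult_ac)
    also have "\<dots> = (\<Sum>T\<in>UNIV. if I \<union> J \<subseteq> T then w T * v I * v J else 0)"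
      by (rule sum.inter_filter) simp
    also have "\<dots> = (\<Sum>T\<in>UNIV. w T * (if I \<subseteq> T then v I else 0) * (if J \<subseteq> T then v J else 0))"
      by (intro sum.cong) auto
    finally show "v I * (\<Sum>T | I \<union> J \<subseteq> T. w T) * v J
      = (\<Sum>T\<in>UNIV. w T * (if I \<subseteq> T then v I else 0) * (if J \<subseteq> T then v J else 0))" .
  qed
  also have "\<dots> = (\<Sum>I\<in>K. \<Sum>T\<in>UNIV. \<Sum>J\<in>K. w T * (if I \<subseteq> T then v I else 0) * (if J \<subseteq> T then v J else 0))"
    by (intro sum.cong refl sum.swap)
  also have "\<dots> = (\<Sum>T\<in>UNIV. \<Sum>I\<in>K. \<Sum>J\<in>K. w T * (if I \<subseteq> T then v I else 0) * (if J \<subseteq> T then v J else 0))"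
    by (rule sum.swap)
  also have "\<dots> = (\<Sum>T\<in>UNIV. w T * (\<Sum>I\<in>K. if I \<subseteq> T then v I else 0)\<^sup>2)"
    by (simp add: power2_eq_square sum_distrib_left sum_distrib_right mult_ac)
  also have "\<dots> = (\<Sum>T\<in>UNIV. w T * (\<Sum>I | I \<in> K \<and> I \<subseteq> T. v I)\<^sup>2)"
    by (simp add: sum.inter_filter)
  finally show ?thesis .
qed

section \<open>Infeasibility\<close>

lemma Las_lift_weight:
  fixes A :: "real ^ 'n ^ 'm"
  assumes Y: "Y \<in> Las_lift k A b" and k: "CARD('n::finite) \<le> k + 1"
  obtains p :: "'n set \<Rightarrow> real" where "(\<Sum>T\<in>UNIV. p T) = 1"
    and "\<And>I J. Y (ones_on I) (ones_on J) = (\<Sum>T | I \<union> J \<subseteq> T. p T)"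
proof -
  obtain p where p: "\<And>I. Y (ones_on I) (ones_on {}) = (\<Sum>T | (I :: 'n set) \<subseteq> T. p T)"
    using moments_of_weight[of "\<lambda>I. Y (ones_on I) (ones_on {})"] by blast
  have "card (I :: 'n set) \<le> k + 1" for I
    using k card_mono[of UNIV I] by (simp del: One_nat_def)
  then have mem: "ones_on (I :: 'n set) \<in> A_plus (k + 1)" for I
    unfolding A_plus_def by blast
  have "Y (ones_on I) (ones_on J) = Y (ones_on (I \<union> J)) (ones_on {})" for I J :: "'n set"
  proof -
    have "ones_on I \<inter> ones_on J = ones_on (I \<union> J) \<inter> ones_on {}"
      by (simp add: ones_on_Int)
    then show ?thesis using Y mem unfolding Las_lift_def by blast
  qed
  moreover have "(\<Sum>T\<in>UNIV. p T) = 1"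
    using Y p[of "{}"] by (simp add: Las_lift_def ones_on_empty)
  ultimately show ?thesis using p that by metis
qed

text \<open>Testing the constraint of each \<open>S\<close> with the switching \<open>T \<mapsto> (-1)\<^sup>|\<^sup>T\<^sup>| h(|S \<triangle> T|)\<close> of one function
  and summing over \<open>S\<close> makes the coefficient of \<open>p(T)\<close> independent of \<open>T\<close>; only the total mass 1
  of the unknown weight remains.\<close>

lemma Las_lift_averaged:
  assumes Y: "Y \<in> Las_lift k (Q_mat :: real ^ 'n ^ ('n::finite set)) (Q_rhs \<rho>)"
    and k: "k \<ge> CARD('n) \<or> k + 1 = CARD('n) \<and> (\<Sum>U\<in>(UNIV :: 'n set set). h (card U)) = 0"
  shows "0 \<le> (\<Sum>U\<in>(UNIV :: 'n set set). (real (card U) - \<rho>) * (h (card U))\<^sup>2)"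
proof -
  from k have "CARD('n) \<le> k + 1" by linarith
  from Las_lift_weight[OF Y this] obtain p :: "'n set \<Rightarrow> real"
    where p1: "(\<Sum>T\<in>UNIV. p T) = 1"
      and p: "\<And>I J. Y (ones_on I) (ones_on J) = (\<Sum>T | I \<union> J \<subseteq> T. p T)"
    by blast
  have S: "0 \<le> (\<Sum>T\<in>UNIV. p T * (real (card (sym_diff S T)) - \<rho>) * (h (card (sym_diff S T)))\<^sup>2)"
    for S :: "'n set"
  proof -
    define f where "f T = (-1) ^ card T * h (card (sym_diff S T))" for T
    have "(-1) ^ card T * f T = h (card (sym_diff T S))" for T
      by (simp add: f_def Un_commute flip: mult.assoc power_add)
    then have "(\<Sum>T\<in>UNIV. (-1) ^ card T * f T) = (\<Sum>U\<in>(UNIV :: 'n set set). h (card U))"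
      using sum_sym_diff[of "\<lambda>U. h (card U)" S] by simp
    with k have "k \<ge> CARD('n) \<or> k + 1 = CARD('n) \<and> (\<Sum>T\<in>UNIV. (-1) ^ card T * f T) = 0"
      by simp
    then obtain v where v: "\<And>T. f T = (\<Sum>I | card I \<le> k \<and> I \<subseteq> T. v I)"
      using multilinear_expansion by blast
    have "0 \<le> (\<Sum>I | card I \<le> k. \<Sum>J | card J \<le> k. v I * localizing_matrix Q_mat (Q_rhs \<rho>) Y S I J * v J)"
      using Y unfolding Las_lift_def psd_on_def by blast
    also have "\<dots> = (\<Sum>T\<in>UNIV. p T * (real (card (sym_diff S T)) - \<rho>) * (f T)\<^sup>2)"
      unfolding localizing_matrix_moments[of Y p, OF p] moment_quadratic_form v by simp
    finally show ?thesis
      by (simp add: f_def power_mult_distrib flip: power_mult)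
  qed
  define G where "G U = (real (card U) - \<rho>) * (h (card U))\<^sup>2" for U :: "'n set"
  have "0 \<le> (\<Sum>S\<in>UNIV. \<Sum>T\<in>UNIV. p T * G (sym_diff S T))"
    by (rule sum_nonneg) (use S in \<open>simp add: G_def mult.assoc\<close>)
  also have "\<dots> = (\<Sum>T\<in>UNIV. p T * (\<Sum>S\<in>UNIV. G (sym_diff S T)))"
    by (subst sum.swap) (simp add: sum_distrib_left)
  also have "\<dots> = (\<Sum>T\<in>UNIV. p T) * (\<Sum>U\<in>UNIV. G U)"
    by (simp add: sum_sym_diff sum_distrib_right)
  finally show ?thesis by (simp add: p1 G_def)
qed

text \<open>At level \<open>n\<close> the degree is unrestricted, and the indicator of \<open>S\<close> isolates the negative slack
  \<open>-\<rho>\<close> of the vertex \<open>1\<^sub>S\<close>.\<close>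

lemma Las_dimension_empty:
  assumes "\<rho> > 0"
  shows "Las CARD('n) (Q_mat :: real ^ 'n ^ ('n::finite set)) (Q_rhs \<rho>) = {}"
proof -
  have False if "Y \<in> Las_lift CARD('n) (Q_mat :: real ^ 'n ^ ('n set)) (Q_rhs \<rho>)" for Y
  proof -
    have "0 \<le> (\<Sum>U\<in>(UNIV :: 'n set set). (real (card U) - \<rho>) * (if card U = 0 then 1 else 0)\<^sup>2)"
      by (rule Las_lift_averaged[OF that]) simp
    also have "\<dots> = (\<Sum>U\<in>(UNIV :: 'n set set). if U = {} then - \<rho> else 0)"
      by (intro sum.cong) auto
    finally show False using assms by simp
  qed
  then show ?thesis by (auto simp: Las_def)
qed

text \<open>The test function \<open>1 / (|U| - q)\<close> is the extremal vector of the quadratic form at \<open>q\<close>: the form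
  vanishes there, and increasing the parameter beyond \<open>q\<close> makes it negative.\<close>

lemma Las_below_dimension_empty:
  assumes n: "CARD('n) \<ge> 2" and q: "0 < q" "q < 1"
    and root: "(\<Sum>U\<in>(UNIV :: 'n set set). 1 / (real (card U) - q)) = 0"
    and "\<rho> > q"
  shows "Las (CARD('n) - 1) (Q_mat :: real ^ 'n ^ ('n::finite set)) (Q_rhs \<rho>) = {}"
proof -
  have ne: "real k - q \<noteq> 0" for k using q by (cases k) auto
  have False if "Y \<in> Las_lift (CARD('n) - 1) (Q_mat :: real ^ 'n ^ ('n set)) (Q_rhs \<rho>)" for Y
  proof -
    have "0 \<le> (\<Sum>U\<in>(UNIV :: 'n set set). (real (card U) - \<rho>) * (1 / (real (card U) - q))\<^sup>2)"
      by (rule Las_lift_averaged[OF that]) (use n root in simp)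
    also have "\<dots> = (\<Sum>U\<in>(UNIV :: 'n set set). 1 / (real (card U) - q) - (\<rho> - q) * (1 / (real (card U) - q))\<^sup>2)"
    proof (intro sum.cong refl)
      fix U :: "'n set"
      have "(x - \<rho>) * (1 / (x - q))\<^sup>2 = 1 / (x - q) - (\<rho> - q) * (1 / (x - q))\<^sup>2" if "x - q \<noteq> 0" for x
      proof -
        have "(x - \<rho>) * (1 / (x - q))\<^sup>2 = ((x - q) * (1 / (x - q))) * (1 / (x - q)) - (\<rho> - q) * (1 / (x - q))\<^sup>2"
          by (simp only: power2_eq_square) (simp only: algebra_simps)
        then show ?thesis using that by simp
      qed
      then show "(real (card U) - \<rho>) * (1 / (real (card U) - q))\<^sup>2
          = 1 / (real (card U) - q) - (\<rho> - q) * (1 / (real (card U) - q))\<^sup>2"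
        using ne by blast
    qed
    also have "\<dots> = - (\<rho> - q) * (\<Sum>U\<in>(UNIV :: 'n set set). (1 / (real (card U) - q))\<^sup>2)"
      by (simp only: sum_subtractf root mult_minus_left sum_distrib_left diff_0 sum_negf)
    also have "\<dots> < 0"
    proof -
      have "0 < (\<Sum>U\<in>(UNIV :: 'n set set). (1 / (real (card U) - q))\<^sup>2)"
        by (rule sum_pos) (use ne in auto)
      then show ?thesis using \<open>\<rho> > q\<close> by (simp add: mult_neg_pos)
    qed
    finally show False by simp
  qed
  then show ?thesis using n by (auto simp: Las_def)
qed

section \<open>Feasibility of the uniform weight\<close>

text \<open>A polynomial of degree below the dimension is orthogonal to the top character, so its value at
  \<open>S\<close> is a signed sum of its other values, to which Cauchy-Schwarz applies with the positive
  weights \<open>|S \<triangle> T| - q\<close>.\<close>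

lemma uniform_localizing_form_nonneg:
  fixes f :: "'n::finite set \<Rightarrow> real"
  assumes q: "0 < q" "q < 1"
    and root: "(\<Sum>U\<in>(UNIV :: 'n set set). 1 / (real (card U) - q)) = 0"
    and f: "(\<Sum>T\<in>UNIV. (-1) ^ card T * f T) = 0"
  shows "0 \<le> (\<Sum>T\<in>UNIV. (real (card (sym_diff S T)) - q) * (f T)\<^sup>2)"
proof -
  define d where "d T = real (card (sym_diff S T)) - q" for T
  define e :: "'n set \<Rightarrow> real" where "e T = (-1) ^ card T" for T
  have d: "d T > 0" if "T \<noteq> S" for T
  proof -
    have "sym_diff S T \<noteq> {}" using that by auto
    then have "card (sym_diff S T) > 0" by (simp add: card_gt_0_iff del: Un_empty)
    then show ?thesis using q by (simp add: d_def)
  qed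
  have dS: "d S = - q" by (simp add: d_def)
  have e: "(e T)\<^sup>2 = 1" for T by (simp add: e_def flip: power_mult)
  have "(\<Sum>T\<in>UNIV. 1 / d T) = 0"
    using root sum_sym_diff[of "\<lambda>U. 1 / (real (card U) - q)" S] by (simp add: d_def Un_commute)
  then have inv: "(\<Sum>T\<in>UNIV - {S}. 1 / d T) = 1 / q"
    by (simp add: sum.remove[of UNIV S] dS)
  have "e S * f S = - (\<Sum>T\<in>UNIV - {S}. e T * f T)"
    using f by (simp add: sum.remove[of UNIV S] flip: e_def)
  then have "(f S)\<^sup>2 = (\<Sum>T\<in>UNIV - {S}. e T * f T)\<^sup>2"
    by (metis e mult_1 power2_minus power_mult_distrib)
  also have "\<dots> = (\<Sum>T\<in>UNIV - {S}. (e T * sqrt (d T) * f T) * (1 / sqrt (d T)))\<^sup>2"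
  proof -
    have "e T * f T = (e T * sqrt (d T) * f T) * (1 / sqrt (d T))" if "T \<in> UNIV - {S}" for T
      using d[of T] that by simp
    then show ?thesis by (metis (no_types, lifting) sum.cong)
  qed
  also have "\<dots> \<le> (\<Sum>T\<in>UNIV - {S}. (e T * sqrt (d T) * f T)\<^sup>2) * (\<Sum>T\<in>UNIV - {S}. (1 / sqrt (d T))\<^sup>2)"
    by (rule Cauchy_Schwarz_ineq_sum)
  also have "(\<Sum>T\<in>UNIV - {S}. (1 / sqrt (d T))\<^sup>2) = (\<Sum>T\<in>UNIV - {S}. 1 / d T)"
    by (intro sum.cong) (use d in \<open>auto simp: power_divide less_imp_le\<close>)
  also have "(\<Sum>T\<in>UNIV - {S}. (e T * sqrt (d T) * f T)\<^sup>2) = (\<Sum>T\<in>UNIV - {S}. d T * (f T)\<^sup>2)"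
    by (intro sum.cong) (use d e in \<open>auto simp: power_mult_distrib less_imp_le\<close>)
  finally have "q * (f S)\<^sup>2 \<le> (\<Sum>T\<in>UNIV - {S}. d T * (f T)\<^sup>2)"
    using q by (simp add: inv field_simps)
  then have "0 \<le> (\<Sum>T\<in>UNIV. d T * (f T)\<^sup>2)"
    by (simp add: sum.remove[of UNIV S] dS)
  then show ?thesis by (simp add: d_def)
qed

text \<open>The witness is the moment matrix of the uniform distribution on the vertices of the cube; it is a
  Gram matrix, and its localizing matrices test only polynomials of degree at most \<open>k < n\<close>.\<close>

lemma Las_below_dimension_nonempty:
  assumes k: "0 < k" "k < CARD('n)" and q: "0 < q" "q < 1"
    and root: "(\<Sum>U\<in>(UNIV :: 'n set set). 1 / (real (card U) - q)) = 0"
  shows "Las k (Q_mat :: real ^ 'n ^ ('n::finite set)) (Q_rhs q) \<noteq> {}"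
proof -
  define N :: real where "N = 2 ^ CARD('n)"
  have N: "N > 0" by (simp add: N_def)
  define Y :: "(real ^ 'n) set \<Rightarrow> (real ^ 'n) set \<Rightarrow> real"
    where "Y \<alpha> \<beta> = card (\<alpha> \<inter> \<beta>) / N" for \<alpha> \<beta>
  have Y: "Y (ones_on I) (ones_on J) = (\<Sum>T | I \<union> J \<subseteq> T. 1 / N)" for I J
    by (simp add: Y_def ones_on_Int finite_card_ones_on)
  have one: "Y cube_points cube_points = 1"
    using Y[of "{}" "{}"] by (simp add: ones_on_empty N_def card_UNIV_set)
  have psd: "psd_on (A_plus (k + 1)) Y"
    unfolding psd_on_def
  proof (intro conjI allI)
    show "\<forall>\<alpha>\<in>A_plus (k + 1). \<forall>\<beta>\<in>A_plus (k + 1). Y \<alpha> \<beta> = Y \<beta> \<alpha>"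
      by (simp add: Y_def Int_commute)
    fix v :: "(real ^ 'n) set \<Rightarrow> real"
    let ?I = "A_plus (k + 1) :: (real ^ 'n) set set"
    have "v \<alpha> * Y \<alpha> \<beta> * v \<beta> = (\<Sum>x\<in>cube_points. (if x \<in> \<alpha> then v \<alpha> else 0) * (if x \<in> \<beta> then v \<beta> else 0)) / N"
      if "\<alpha> \<in> ?I" for \<alpha> \<beta>
    proof -
      have "\<alpha> \<inter> \<beta> = {x \<in> cube_points. x \<in> \<alpha> \<inter> \<beta>}"
        using that by (auto simp: A_plus_def ones_on_def)
      then have "real (card (\<alpha> \<inter> \<beta>)) = (\<Sum>x\<in>{x \<in> cube_points. x \<in> \<alpha> \<inter> \<beta>}. 1)"
        by simp
      also have "\<dots> = (\<Sum>x\<in>cube_points. if x \<in> \<alpha> \<inter> \<beta> then 1 else 0)"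
        by (rule sum.inter_filter) (use finite_card_ones_on(1)[of "{}"] in \<open>simp add: ones_on_empty\<close>)
      finally have "v \<alpha> * Y \<alpha> \<beta> * v \<beta> = (\<Sum>x\<in>cube_points. v \<alpha> * (if x \<in> \<alpha> \<inter> \<beta> then 1 else 0) * v \<beta>) / N"
        by (simp add: Y_def sum_distrib_left sum_distrib_right)
      also have "(\<Sum>x\<in>cube_points. v \<alpha> * (if x \<in> \<alpha> \<inter> \<beta> then 1 else 0) * v \<beta>)
        = (\<Sum>x\<in>cube_points. (if x \<in> \<alpha> then v \<alpha> else 0) * (if x \<in> \<beta> then v \<beta> else 0))"
        by (intro sum.cong) auto
      finally show ?thesis .
    qed
    then have "(\<Sum>\<alpha>\<in>?I. \<Sum>\<beta>\<in>?I. v \<alpha> * Y \<alpha> \<beta> * v \<beta>)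
      = (\<Sum>\<alpha>\<in>?I. \<Sum>\<beta>\<in>?I. \<Sum>x\<in>cube_points. (if x \<in> \<alpha> then v \<alpha> else 0) * (if x \<in> \<beta> then v \<beta> else 0)) / N"
      by (simp add: sum_divide_distrib)
    also have "\<dots> = (\<Sum>\<alpha>\<in>?I. \<Sum>x\<in>cube_points. \<Sum>\<beta>\<in>?I. (if x \<in> \<alpha> then v \<alpha> else 0) * (if x \<in> \<beta> then v \<beta> else 0)) / N"
      by (intro arg_cong[of _ _ "\<lambda>s. s / N"] sum.cong refl sum.swap)
    also have "\<dots> = (\<Sum>x\<in>cube_points. \<Sum>\<alpha>\<in>?I. \<Sum>\<beta>\<in>?I. (if x \<in> \<alpha> then v \<alpha> else 0) * (if x \<in> \<beta> then v \<beta> else 0)) / N"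
      by (intro arg_cong[of _ _ "\<lambda>s. s / N"] sum.swap)
    also have "\<dots> = (\<Sum>x\<in>cube_points. (\<Sum>\<alpha>\<in>?I. if x \<in> \<alpha> then v \<alpha> else 0)\<^sup>2) / N"
      by (simp only: power2_eq_square sum_product)
    also have "\<dots> \<ge> 0" using N by (simp add: sum_nonneg)
    finally show "0 \<le> (\<Sum>\<alpha>\<in>?I. \<Sum>\<beta>\<in>?I. v \<alpha> * Y \<alpha> \<beta> * v \<beta>)" .
  qed
  have entry: "localizing_matrix Q_mat (Q_rhs q) Y S I J
      = (\<Sum>T | I \<union> J \<subseteq> T. 1 / N * (real (card (sym_diff S T)) - q))" for S I J
    using Y by (rule localizing_matrix_moments)
  have loc: "psd_on {S. card S \<le> k} (localizing_matrix Q_mat (Q_rhs q) Y S)" for S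
    unfolding psd_on_def entry
  proof (intro conjI allI)
    fix v :: "'n set \<Rightarrow> real"
    define f where "f T = (\<Sum>I | I \<in> {I. card I \<le> k} \<and> I \<subseteq> T. v I)" for T
    have "(\<Sum>T\<in>UNIV. (-1) ^ card T * f T)
        = (\<Sum>T\<in>UNIV. \<Sum>I | I \<in> {I. card I \<le> k} \<and> I \<subseteq> T. (-1) ^ card T * v I)"
      by (simp add: f_def sum_distrib_left)
    also have "\<dots> = (\<Sum>I\<in>{I. card I \<le> k}. \<Sum>T | T \<in> UNIV \<and> I \<subseteq> T. (-1) ^ card T * v I)"
      by (rule sum.swap_restrict[symmetric]) auto
    also have "\<dots> = 0"
    proof (rule sum.neutral, rule ballI)
      fix I :: "'n set" assume "I \<in> {I. card I \<le> k}"
      then have "I \<noteq> UNIV" using k by auto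
      then show "(\<Sum>T | T \<in> UNIV \<and> I \<subseteq> T. (-1) ^ card T * v I) = 0"
        using alternating_sum_supersets[of I] by (simp flip: sum_distrib_right)
    qed
    finally have "0 \<le> (\<Sum>T\<in>UNIV. (real (card (sym_diff S T)) - q) * (f T)\<^sup>2)"
      by (rule uniform_localizing_form_nonneg[OF q root])
    then have "0 \<le> (\<Sum>T\<in>UNIV. (real (card (sym_diff S T)) - q) * (f T)\<^sup>2) / N"
      using N by simp
    also have "\<dots> = (\<Sum>T\<in>UNIV. 1 / N * (real (card (sym_diff S T)) - q) * (f T)\<^sup>2)"
      by (simp add: sum_divide_distrib)
    finally show "0 \<le> (\<Sum>I | card I \<le> k. \<Sum>J | card J \<le> k.
        v I * (\<Sum>T | I \<union> J \<subseteq> T. 1 / N * (real (card (sym_diff S T)) - q)) * v J)"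
      unfolding moment_quadratic_form f_def .
  qed (simp add: Un_commute)
  have "Y \<in> Las_lift k (Q_mat :: real ^ 'n ^ ('n set)) (Q_rhs q)"
    using psd one loc unfolding Las_lift_def by (simp add: Y_def)
  then have "(\<chi> i. Y (ones_on {i}) cube_points) \<in> Las k (Q_mat :: real ^ 'n ^ ('n set)) (Q_rhs q)"
    using k one by (auto simp: Las_def)
  then show ?thesis by blast
qed

section \<open>The polytope and its integer hull\<close>

lemma Q_poly_nonempty:
  fixes \<rho> :: real
  assumes "2 * \<rho> \<le> CARD('n)"
  shows "(Q_poly \<rho> :: (real ^ 'n::finite) set) \<noteq> {}"
proof -
  have half: "(\<Sum>i\<in>S. 1 - 1/2) + (\<Sum>i\<in>-S. 1/2) = real CARD('n) / 2" for S :: "'n set"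
  proof -
    have "card S + card (- S) = CARD('n)"
      by (subst card_Un_disjoint[symmetric]) auto
    then have "real (card S) + real (card (- S)) = real CARD('n)"
      by (simp flip: of_nat_add)
    then show ?thesis by (simp flip: add_divide_distrib)
  qed
  have "\<rho> \<le> (\<Sum>i\<in>S. 1 - 1/2) + (\<Sum>i\<in>-S. 1/2)" for S :: "'n set"
    using assms half[of S] by linarith
  then have "(\<chi> i. 1/2) \<in> (Q_poly \<rho> :: (real ^ 'n) set)"
    by (simp add: Q_poly_def del: sum_constant)
  then show ?thesis by blast
qed

lemma integer_hull_Q_empty:
  assumes "\<rho> > 0"
  shows "integer_hull (box_polytope (Q_mat :: real ^ 'n ^ ('n::finite set)) (Q_rhs \<rho>)) = {}"
proof -
  have False if x: "x \<in> Q_poly \<rho>" "x \<in> cube_points" for x :: "real ^ 'n"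
  proof -
    let ?S = "{i. x $ i = 1}"
    have "x $ i = 0" if "i \<in> - ?S" for i using x(2) that by (auto simp: cube_points_def)
    then have "(\<Sum>i\<in>-?S. x $ i) = 0" by (intro sum.neutral) blast
    then have "(\<Sum>i\<in>?S. 1 - x $ i) + (\<Sum>i\<in>-?S. x $ i) = 0" by simp
    moreover have "(\<Sum>i\<in>?S. 1 - x $ i) + (\<Sum>i\<in>-?S. x $ i) \<ge> \<rho>"
      using x(1) unfolding Q_poly_def by blast
    ultimately show False using assms by linarith
  qed
  then show ?thesis by (auto simp: integer_hull_def box_polytope_Q)
qed

lemma Las_rank_Q_at_root:
  assumes n: "CARD('n) \<ge> 2" and q: "0 < q" "q < 1"
    and root: "(\<Sum>U\<in>(UNIV :: 'n set set). 1 / (real (card U) - q)) = 0"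
  shows "is_Las_rank (Q_mat :: real ^ 'n ^ ('n::finite set)) (Q_rhs q) CARD('n)"
    and "is_Las_rank (Q_mat :: real ^ 'n ^ ('n set)) (Q_rhs \<rho>) CARD('n) \<Longrightarrow> \<rho> \<le> q"
proof -
  have "Las k (Q_mat :: real ^ 'n ^ ('n set)) (Q_rhs q) \<noteq> {}" if "k < CARD('n)" for k
  proof (cases "k = 0")
    case True
    have "2 * q \<le> CARD('n)" using n q by linarith
    then show ?thesis using True Q_poly_nonempty by (simp add: Las_def box_polytope_Q)
  next
    case False
    then show ?thesis using Las_below_dimension_nonempty that q root by blast
  qed
  then show "is_Las_rank (Q_mat :: real ^ 'n ^ ('n set)) (Q_rhs q) CARD('n)"
    using q by (simp add: is_Las_rank_def integer_hull_Q_empty Las_dimension_empty)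
next
  assume rank: "is_Las_rank (Q_mat :: real ^ 'n ^ ('n set)) (Q_rhs \<rho>) CARD('n)"
  show "\<rho> \<le> q"
  proof (rule ccontr)
    assume "\<not> \<rho> \<le> q"
    then have "\<rho> > q" by simp
    have "Las (CARD('n) - 1) (Q_mat :: real ^ 'n ^ ('n set)) (Q_rhs \<rho>) \<noteq> {}"
      using rank n q \<open>\<rho> > q\<close> by (simp add: is_Las_rank_def integer_hull_Q_empty)
    then show False using Las_below_dimension_empty[OF n q root \<open>\<rho> > q\<close>] by blast
  qed
qed

section \<open>Locating the root\<close>

text \<open>The estimate \<open>(k + 1) / (k - \<rho>) \<le> 2 / (1 - \<rho>)\<close>, sharp at \<open>k = 1\<close>, reduces the sum to that of
  \<open>1 / (|U| + 1)\<close>, which absorption of the binomial coefficients evaluates; the given \<open>\<rho>\<close> is the one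
  for which the resulting bound equals 1.\<close>

lemma root_sum_at_lower_bound:
  assumes \<rho>: "0 < \<rho>" "\<rho> < 1" "\<rho> * (2 ^ (CARD('n) + 2) - real CARD('n) - 3) = real CARD('n) + 1"
  shows "(\<Sum>U\<in>UNIV - {{}::'n::finite set}. \<rho> / (real (card U) - \<rho>)) \<le> 1"
proof -
  let ?n = "CARD('n)"
  have "(\<Sum>U\<in>(UNIV :: 'n set set). 1 / (real (card U) + 1)) = (\<Sum>k\<le>?n. (?n choose k) * (1 / (real k + 1)))"
    by (rule sum_card_subsets)
  also have "(real ?n + 1) * \<dots> = (\<Sum>k\<le>?n. real (Suc ?n choose Suc k))"
  proof -
    have "(real ?n + 1) * ((?n choose k) * (1 / (real k + 1))) = real (Suc ?n choose Suc k)" for k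
    proof -
      have "real (Suc k) * real (Suc ?n choose Suc k) = real (Suc ?n) * real (?n choose k)"
        by (metis Suc_times_binomial of_nat_mult)
      then show ?thesis by (simp add: field_simps)
    qed
    then show ?thesis by (simp only: sum_distrib_left)
  qed
  also have "\<dots> = 2 ^ (?n + 1) - 1"
  proof -
    have "(\<Sum>k\<le>Suc ?n. Suc ?n choose k) = 2 ^ (?n + 1)" by (simp add: choose_row_sum del: sum.atMost_Suc)
    then have "1 + (\<Sum>k\<le>?n. Suc ?n choose Suc k) = 2 ^ (?n + 1)"
      by (simp only: sum.atMost_Suc_shift) simp
    then have "real (1 + (\<Sum>k\<le>?n. Suc ?n choose Suc k)) = real (2 ^ (?n + 1))" by simp
    then show ?thesis by simp
  qed
  finally have "(real ?n + 1) * (\<Sum>U\<in>(UNIV :: 'n set set). 1 / (real (card U) + 1)) = 2 ^ (?n + 1) - 1" .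
  then have harm: "(real ?n + 1) * (\<Sum>U\<in>UNIV - {{}::'n set}. 1 / (real (card U) + 1)) = 2 ^ (?n + 1) - real ?n - 2"
    by (simp add: sum.remove[of UNIV "{}"] distrib_left)
  have "(\<Sum>U\<in>UNIV - {{}::'n set}. \<rho> / (real (card U) - \<rho>))
      \<le> (\<Sum>U\<in>UNIV - {{}::'n set}. 2 * \<rho> / (1 - \<rho>) * (1 / (real (card U) + 1)))"
  proof (rule sum_mono)
    fix U assume "U \<in> UNIV - {{}::'n set}"
    then have "card U > 0" by (simp add: card_gt_0_iff)
    then have U: "real (card U) \<ge> 1" by simp
    then have "(1 - \<rho>) * (real (card U) + 1) \<le> 2 * (real (card U) - \<rho>)"
      using \<rho> mult_left_mono[of 1 "real (card U)" "1 + \<rho>"] by (simp add: algebra_simps)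
    then have "\<rho> * ((1 - \<rho>) * (real (card U) + 1)) \<le> \<rho> * (2 * (real (card U) - \<rho>))"
      using \<rho> by simp
    then show "\<rho> / (real (card U) - \<rho>) \<le> 2 * \<rho> / (1 - \<rho>) * (1 / (real (card U) + 1))"
      using \<rho> U by (simp add: divide_simps mult_ac)
  qed
  also have "\<dots> = 2 * \<rho> / (1 - \<rho>) * (\<Sum>U\<in>UNIV - {{}::'n set}. 1 / (real (card U) + 1))"
    by (simp only: sum_distrib_left)
  also have "\<dots> = 2 * \<rho> / (1 - \<rho>) * ((2 ^ (?n + 1) - real ?n - 2) / (real ?n + 1))"
    using harm by (simp add: eq_divide_eq mult.commute)
  also have "\<dots> = (\<rho> * (2 ^ (?n + 2) - real ?n - 3) - (real ?n + 1) * \<rho>) / ((1 - \<rho>) * (real ?n + 1))"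
    by (simp add: times_divide_times_eq) (simp add: algebra_simps)
  also have "\<dots> = 1"
    using \<rho>(2) unfolding \<rho>(3) by (simp add: divide_eq_1_iff) (simp add: algebra_simps)
  finally show ?thesis .
qed

text \<open>The convex function \<open>1 / x\<close> lies above its tangent at \<open>c = (2\<^sup>n - 1) \<rho>\<close>, which is the mean of the
  numbers \<open>|U| - \<rho>\<close> over the nonempty sets \<open>U\<close> for the given \<open>\<rho>\<close>.\<close>

lemma root_sum_at_upper_bound:
  assumes \<rho>: "0 < \<rho>" "\<rho> < 1" "\<rho> * (2 ^ (CARD('n) + 1) - 2) = real CARD('n)"
  shows "1 \<le> (\<Sum>U\<in>UNIV - {{}::'n::finite set}. \<rho> / (real (card U) - \<rho>))"
proof -
  let ?n = "CARD('n)"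
  define N :: real where "N = 2 ^ ?n - 1"
  have "?n > 0" by simp
  have "real ?n = \<rho> * (2 * N)" using \<rho>(3) by (simp add: N_def algebra_simps)
  then have N: "N > 0" using \<rho>(1) \<open>?n > 0\<close> by (metis of_nat_0_less_iff zero_less_mult_pos zero_less_mult_pos zero_less_numeral)
  define c where "c = \<rho> * N"
  have c: "c > 0" using N \<rho> by (simp add: c_def)
  have cardN: "real (card (UNIV - {{}::'n set})) = N"
    by (simp add: N_def card_Diff_singleton card_UNIV_set of_nat_diff)
  have "2 * real (\<Sum>i\<le>?n. i * (?n choose i)) = real ?n * 2 ^ ?n"
    unfolding choose_linear_sum using \<open>?n > 0\<close> by (cases ?n) (auto simp: algebra_simps)
  then have "2 * (\<Sum>U\<in>(UNIV :: 'n set set). real (card U)) = real ?n * 2 ^ ?n"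
    by (simp add: sum_card_subsets mult.commute)
  then have "(\<Sum>U\<in>UNIV - {{}::'n set}. real (card U)) = \<rho> * N * (N + 1)"
    unfolding \<open>real ?n = \<rho> * (2 * N)\<close> by (simp add: sum.remove[of UNIV "{}"] N_def algebra_simps)
  then have mean: "(\<Sum>U\<in>UNIV - {{}::'n set}. real (card U) - \<rho>) = N * c"
    by (simp add: sum_subtractf cardN[simplified] c_def algebra_simps)
  have "1 = \<rho> * (2 / c * N - N * c / c\<^sup>2)"
    using c N \<rho> by (simp add: c_def field_simps power2_eq_square)
  also have "\<dots> = \<rho> * (\<Sum>U\<in>UNIV - {{}::'n set}. 2 / c - (real (card U) - \<rho>) / c\<^sup>2)"
    unfolding sum_subtractf[of "\<lambda>_. 2 / c"] sum_divide_distrib[symmetric] mean sum_constant cardN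
    by simp
  also have "\<dots> \<le> \<rho> * (\<Sum>U\<in>UNIV - {{}::'n set}. 1 / (real (card U) - \<rho>))"
  proof (intro mult_left_mono sum_mono)
    fix U assume "U \<in> UNIV - {{}::'n set}"
    then have "card U > 0" by (simp add: card_gt_0_iff)
    then have x: "real (card U) - \<rho> > 0" using \<rho> by linarith
    have "2 / c - x / c\<^sup>2 \<le> 1 / x" if "x > 0" for x
    proof -
      have "1 / x - (2 / c - x / c\<^sup>2) = (x - c)\<^sup>2 / (x * c\<^sup>2)"
        using c that by (simp add: field_simps power2_eq_square)
      then show ?thesis using c that by (smt (verit) divide_nonneg_nonneg mult_nonneg_nonneg zero_le_power2)
    qed
    then show "2 / c - (real (card U) - \<rho>) / c\<^sup>2 \<le> 1 / (real (card U) - \<rho>)" using x .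
  qed (use \<rho> in simp)
  finally show ?thesis by (simp add: sum_distrib_left)
qed

lemma root_exists:
  assumes n: "CARD('n::finite) \<ge> 2"
  obtains q where "(real CARD('n) + 1) / (2 ^ (CARD('n) + 2) - real CARD('n) - 3) \<le> q"
    and "q \<le> real CARD('n) / (2 ^ (CARD('n) + 1) - 2)" and "0 < q" and "q < 1"
    and "(\<Sum>U\<in>(UNIV :: 'n set set). 1 / (real (card U) - q)) = 0"
proof -
  define n where "n = real CARD('n)"
  define M :: real where "M = 2 ^ (CARD('n) + 1)"
  have "real (CARD('n) + 2) < M"
  proof -
    have "CARD('n) + 2 < 2 ^ (CARD('n) + 1)"
    proof -
      have "k + 2 < 2 ^ (k + 1)" if "k \<ge> 2" for k :: nat
        using that by (induction k rule: nat_induct_at_least) auto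
      then show ?thesis using n .
    qed
    then show ?thesis unfolding M_def by (metis of_nat_less_iff of_nat_numeral of_nat_power)
  qed
  then have M: "M > n + 2" by (simp add: n_def)
  have n2: "n \<ge> 2" using n by (simp add: n_def)
  let ?l = "(n + 1) / (2 * M - n - 3)" and ?u = "n / (M - 2)"
  let ?F = "\<lambda>\<rho>. \<Sum>U\<in>UNIV - {{}::'n set}. \<rho> / (real (card U) - \<rho>)"
  have l: "0 < ?l" "?l < 1" and u: "0 < ?u" "?u < 1" using M n2 by (auto simp: field_simps)
  \<comment> \<open>the difference of the cross products in \<open>?l \<le> ?u\<close>, factored\<close>
  have "0 \<le> (n - 1) * (M - n - 2)" using M n2 by simp
  then have "(n + 1) * (M - 2) \<le> n * (2 * M - n - 3)" by (simp add: algebra_simps)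
  then have "?l \<le> ?u" using M n2 by (simp add: divide_simps mult_ac)
  moreover have "?F ?l \<le> 1"
    by (rule root_sum_at_lower_bound) (use l M n2 in \<open>auto simp: n_def M_def\<close>)
  moreover have "1 \<le> ?F ?u"
    by (rule root_sum_at_upper_bound) (use u M n2 in \<open>auto simp: n_def M_def\<close>)
  moreover have "continuous_on {?l..?u} ?F"
  proof (intro continuous_intros ballI)
    fix U \<rho> assume "U \<in> UNIV - {{}::'n set}" "\<rho> \<in> {?l..?u}"
    then have "card U > 0" "\<rho> < 1" using u by (auto simp: card_gt_0_iff)
    then show "real (card U) - \<rho> \<noteq> 0" by linarith
  qed
  ultimately obtain q where q: "?l \<le> q" "q \<le> ?u" "?F q = 1"
    using IVT'[of ?F ?l 1 ?u] by blast
  have "0 < q" "q < 1" using q l u by linarith+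
  have "q * (\<Sum>U\<in>UNIV - {{}::'n set}. 1 / (real (card U) - q)) = 1"
    using q(3) by (simp add: sum_distrib_left)
  then have "(\<Sum>U\<in>(UNIV :: 'n set set). 1 / (real (card U) - q)) = 0"
    using \<open>0 < q\<close> by (simp add: sum.remove[of UNIV "{}"] field_simps)
  with q \<open>0 < q\<close> \<open>q < 1\<close> show thesis using that by (simp add: n_def M_def)
qed

section \<open>The largest parameter of full rank\<close>

theorem theorem14:
  assumes "CARD('n::finite) \<ge> 2"
  shows "\<exists>q::real.
    is_Las_rank (Q_mat :: real ^ 'n ^ ('n set)) (Q_rhs q) CARD('n) \<and>
    (\<forall>\<rho>. is_Las_rank (Q_mat :: real ^ 'n ^ ('n set)) (Q_rhs \<rho>) CARD('n) \<longrightarrow> \<rho> \<le> q) \<and>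
    (real CARD('n) + 1) / (2 ^ (CARD('n) + 2) - real CARD('n) - 3) \<le> q \<and>
    q \<le> real CARD('n) / (2 ^ (CARD('n) + 1) - 2)"
proof -
  obtain q where "(real CARD('n) + 1) / (2 ^ (CARD('n) + 2) - real CARD('n) - 3) \<le> q"
    "q \<le> real CARD('n) / (2 ^ (CARD('n) + 1) - 2)" "0 < q" "q < 1"
    "(\<Sum>U\<in>(UNIV :: 'n set set). 1 / (real (card U) - q)) = 0"
    using root_exists[OF assms] .
  then show ?thesis using Las_rank_Q_at_root[OF assms] by blast
qed

end
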